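(* Let $S\subseteq V^{\setminus i}$ and define $\mathrm{ub}_f(S)=f(S)$ and $$\mathrm{ub}_g(S)=f(S)+\sum_{j_S\in\mathcal{D}_u^{S}}\ \min_{j\in\mathcal{D}_u^{V^{\setminus i}}:\ j^{S}=j_S} g\big(V^{\setminus i},\,j,\,\alpha_{\mathrm{ess}}/q(S)\big).$$ Then $\mathrm{ub}_g(S)\le \mathrm{ub}_f(S)$, and $\mathrm{ub}_g(S)\ge \mathrm{LBDeu}(T)$ for every $T$ with $S\subset T\subseteq V^{\setminus i}$.
   Context: Let $V=\{1,\dots,n\}$ index discrete random variables, fix a child variable $i\in V$ and put $V^{\setminus i}=V\setminus\{i\}$. Each variable $v$ has a finite nonempty state space $c(v)$; for $S\subseteq V$, $c(S)=\prod_{v\in S}c(v)$ (a singleton if $S=\emptyset$) and $q(S)=|c(S)|$; $q(i)=|c(i)|$. For $j\in c(S')$ and $S\subseteq S'$, $j^{S}\in c(S)$ is the projection of $j$. The data $\mathcal{D}$ is a finite multiset of elements of $c(V)$; $\mathcal{D}^{S}$ is the multiset of projections onto $S$, and $\mathcal{D}_u^{S}$ is the set of distinct elements of $\mathcal{D}^{S}$. For $S\subseteq V^{\setminus i}$ and $j\in c(S)$, $\mathcal{D}_u^{S\cup\{i\}}(j)$ is the set of elements of $\mathcal{D}_u^{S\cup\{i\}}$ whose projection onto $S$ is $j$; $n_j$ is the number of occurrences of $j$ in $\mathcal{D}^{S}$, and for $k\in c(i)$, $n_{j,k}$ is the number of elements of $\mathcal{D}^{S\cup\{i\}}$ (with multiplicity)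 with $S$-part $j$ and $i$-part $k$, so $n_j=\sum_k n_{j,k}$. Fix $\alpha_{\mathrm{ess}}>0$. For $j\in c(S)$, $\alpha_j=\alpha_{\mathrm{ess}}/q(S)$ and $\alpha_{j,k}=\alpha_{\mathrm{ess}}/(q(S)q(i))$. With $\Gamma_\alpha(x)=\Gamma(x+\alpha)/\Gamma(\alpha)$, $$\mathrm{LLBDeu}(S,j)=-\log\Gamma_{\alpha_j}(n_j)+\sum_{k\in c(i)}\log\Gamma_{\alpha_{j,k}}(n_{j,k}),\qquad \mathrm{LBDeu}(S)=\sum_{j\in\mathcal{D}_u^{S}}\mathrm{LLBDeu}(S,j).$$ For $S\subseteq V^{\setminus i}$ and $j\in\mathcal{D}_u^{S}$: $f(S,j)=-|\mathcal{D}_u^{S\cup\{i\}}(j)|\log q(i)$ and $f(S)=\sum_{j\in\mathcal{D}_u^{S}}f(S,j)$. For $\alpha>0$, $g(S,j,\alpha)=-\sum_{l=1}^{k'-1}\log(1+n_{j,l}/\alpha)$, where the counts $(n_{j,k})_{k\in c(i)}$ are listed in non-increasing order as $n_{j,1}\ge\dots\ge n_{j,q(i)}$ and $k'$ is the largest index with $n_{j,k'}>0$. The symbol $\subset$ denotes proper inclusion. *)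

theory Defs
  imports "HOL-Analysis.Analysis" "HOL-Library.Multiset" "HOL-Library.FuncSet"
begin

(* A joint state of the variables in S is an extensional function in PiE S c, so the
   projection onto S is restrict _ S, and there is exactly one joint state of {}. *)

definition joint_states :: "('v \<Rightarrow> 'a set) \<Rightarrow> 'v set \<Rightarrow> ('v \<Rightarrow> 'a) set" where
  "joint_states c S = PiE S c"

definition num_states :: "('v \<Rightarrow> 'a set) \<Rightarrow> 'v set \<Rightarrow> nat" where
  "num_states c S = card (joint_states c S)"

definition data_proj :: "('v \<Rightarrow> 'a) multiset \<Rightarrow> 'v set \<Rightarrow> ('v \<Rightarrow> 'a) multiset" where
  "data_proj D S = image_mset (\<lambda>x. restrict x S) D"

definition distinct_data :: "('v \<Rightarrow> 'a) multiset \<Rightarrow> 'v set \<Rightarrow> ('v \<Rightarrow> 'a) set" where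
  "distinct_data D S = set_mset (data_proj D S)"

definition distinct_extensions ::
    "('v \<Rightarrow> 'a) multiset \<Rightarrow> 'v \<Rightarrow> 'v set \<Rightarrow> ('v \<Rightarrow> 'a) \<Rightarrow> ('v \<Rightarrow> 'a) set" where
  "distinct_extensions D i S j = {x \<in> distinct_data D (S \<union> {i}). restrict x S = j}"

definition parent_count :: "('v \<Rightarrow> 'a) multiset \<Rightarrow> 'v set \<Rightarrow> ('v \<Rightarrow> 'a) \<Rightarrow> nat" where
  "parent_count D S j = count (data_proj D S) j"

definition family_count ::
    "('v \<Rightarrow> 'a) multiset \<Rightarrow> 'v \<Rightarrow> 'v set \<Rightarrow> ('v \<Rightarrow> 'a) \<Rightarrow> 'a \<Rightarrow> nat" where
  "family_count D i S j k =
     size {#x \<in># data_proj D (S \<union> {i}). restrict x S = j \<and> x i = k#}"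

definition Gamma_quot :: "real \<Rightarrow> real \<Rightarrow> real" where
  "Gamma_quot a x = Gamma (x + a) / Gamma a"

definition LLBDeu ::
    "('v \<Rightarrow> 'a set) \<Rightarrow> ('v \<Rightarrow> 'a) multiset \<Rightarrow> real \<Rightarrow> 'v \<Rightarrow> 'v set \<Rightarrow> ('v \<Rightarrow> 'a) \<Rightarrow> real" where
  "LLBDeu c D \<alpha>ess i S j =
     - ln (Gamma_quot (\<alpha>ess / real (num_states c S)) (real (parent_count D S j)))
     + (\<Sum>k\<in>c i. ln (Gamma_quot (\<alpha>ess / (real (num_states c S) * real (card (c i))))
                                 (real (family_count D i S j k))))"

definition LBDeu ::
    "('v \<Rightarrow> 'a set) \<Rightarrow> ('v \<Rightarrow> 'a) multiset \<Rightarrow> real \<Rightarrow> 'v \<Rightarrow> 'v set \<Rightarrow> real" where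
  "LBDeu c D \<alpha>ess i S = (\<Sum>j\<in>distinct_data D S. LLBDeu c D \<alpha>ess i S j)"

definition f_local ::
    "('v \<Rightarrow> 'a set) \<Rightarrow> ('v \<Rightarrow> 'a) multiset \<Rightarrow> 'v \<Rightarrow> 'v set \<Rightarrow> ('v \<Rightarrow> 'a) \<Rightarrow> real" where
  "f_local c D i S j = - real (card (distinct_extensions D i S j)) * ln (real (card (c i)))"

definition f_total :: "('v \<Rightarrow> 'a set) \<Rightarrow> ('v \<Rightarrow> 'a) multiset \<Rightarrow> 'v \<Rightarrow> 'v set \<Rightarrow> real" where
  "f_total c D i S = (\<Sum>j\<in>distinct_data D S. f_local c D i S j)"

definition sorted_counts ::
    "('v \<Rightarrow> 'a set) \<Rightarrow> ('v \<Rightarrow> 'a) multiset \<Rightarrow> 'v \<Rightarrow> 'v set \<Rightarrow> ('v \<Rightarrow> 'a) \<Rightarrow> nat list" where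
  "sorted_counts c D i S j =
     rev (sorted_list_of_multiset (image_mset (family_count D i S j) (mset_set (c i))))"

(* Lists are indexed from 0, so the l-th largest count is sorted_counts c D i S j ! (l - 1).
   The Max ranges over a nonempty set whenever j occurs in the projected data. *)

definition last_pos_index ::
    "('v \<Rightarrow> 'a set) \<Rightarrow> ('v \<Rightarrow> 'a) multiset \<Rightarrow> 'v \<Rightarrow> 'v set \<Rightarrow> ('v \<Rightarrow> 'a) \<Rightarrow> nat" where
  "last_pos_index c D i S j =
     Max {l \<in> {1..card (c i)}. sorted_counts c D i S j ! (l - 1) > 0}"

definition g_local ::
    "('v \<Rightarrow> 'a set) \<Rightarrow> ('v \<Rightarrow> 'a) multiset \<Rightarrow> 'v \<Rightarrow> 'v set \<Rightarrow> ('v \<Rightarrow> 'a) \<Rightarrow> real \<Rightarrow> real" where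
  "g_local c D i S j \<alpha> =
     - (\<Sum>l\<in>{1..last_pos_index c D i S j - 1}.
          ln (1 + real (sorted_counts c D i S j ! (l - 1)) / \<alpha>))"

definition ub_f :: "('v \<Rightarrow> 'a set) \<Rightarrow> ('v \<Rightarrow> 'a) multiset \<Rightarrow> 'v \<Rightarrow> 'v set \<Rightarrow> real" where
  "ub_f c D i S = f_total c D i S"

definition ub_g ::
    "'v set \<Rightarrow> ('v \<Rightarrow> 'a set) \<Rightarrow> ('v \<Rightarrow> 'a) multiset \<Rightarrow> real \<Rightarrow> 'v \<Rightarrow> 'v set \<Rightarrow> real" where
  "ub_g V c D \<alpha>ess i S = f_total c D i S
     + (\<Sum>jS\<in>distinct_data D S.
          Min ((\<lambda>j. g_local c D i (V - {i}) j (\<alpha>ess / real (num_states c S)))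
               ` {j \<in> distinct_data D (V - {i}). restrict j S = jS}))"

end

(* Write a = alpha_ess/q(T) and let n_k be the counts of one parent configuration j of T.
   Since Gamma_a(n) is the rising factorial a(a+1)...(a+n-1), the local score is a log-ratio of
   rising factorials.  Replacing a/q(i) by a costs a factor q(i) for every positive count, which
   gives f; and splitting the denominator Gamma_a(sum n_k) along the counts leaves, for every
   count but one, a factor of at least 1 + n_k/a, which gives g when the omitted count is the
   smallest positive one.  Both f and g then move in the right direction: enlarging the parent set
   only adds distinct data points, and refining the configuration or increasing a only decreases
   the terms of g. *)
theory Submission
  imports Defs
begin

section \<open>Rising factorials\<close>

text \<open>The counts are natural numbers, so every Gamma quotient in the score is a finite product
  and can be compared factor by factor.\<close>

lemma Gamma_quot_eq_pochhammer:
  assumes "a > 0"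
  shows "Gamma_quot a (real n) = pochhammer a n"
proof -
  have "a \<notin> \<int>\<^sub>\<le>\<^sub>0" using assms by (auto elim!: nonpos_Ints_cases)
  then show ?thesis by (simp add: Gamma_quot_def pochhammer_Gamma add.commute)
qed

lemma pochhammer_mono:
  fixes a b :: real
  assumes "0 < a" "a \<le> b"
  shows "pochhammer a n \<le> pochhammer b n"
  unfolding pochhammer_prod using assms by (intro prod_mono) auto

text \<open>The product on the right splits as \<open>pochhammer a p * pochhammer (a + p) m\<close>.
  The first factors of \<open>pochhammer (a + p) m\<close> and \<open>pochhammer a m\<close> are
  \<open>a + p\<close> and \<open>a\<close>, with ratio exactly \<open>1 + p / a\<close>; each later
  factor is at least as large after the shift by \<open>p\<close>. Positivity of \<open>m\<close>
  guarantees that there is a first factor.\<close>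

lemma pochhammer_add_ge:
  fixes a :: real
  assumes "0 < a" "0 < m"
  shows "pochhammer a m * (pochhammer a p * (1 + real p / a)) \<le> pochhammer a (m + p)"
proof -
  obtain l where m: "m = Suc l" using assms(2) gr0_implies_Suc by blast
  have "pochhammer a m * (1 + real p / a) = (a + real p) * pochhammer (a + 1) l"
    using assms(1) by (simp add: m pochhammer_rec field_simps)
  also have "\<dots> \<le> (a + real p) * pochhammer (a + real p + 1) l"
    using assms(1) by (intro mult_left_mono pochhammer_mono) auto
  also have "\<dots> = pochhammer (a + real p) m"
    by (simp add: m pochhammer_rec)
  finally have "pochhammer a p * (pochhammer a m * (1 + real p / a))
      \<le> pochhammer a p * pochhammer (a + real p) m"
    using assms(1) by (intro mult_left_mono pochhammer_nonneg) auto
  also have "\<dots> = pochhammer a (m + p)"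
    using pochhammer_product'[of a p m] by (simp add: add.commute)
  finally show ?thesis by (simp add: ac_simps)
qed

text \<open>The counts \<open>N k\<close> are split off one at a time with
  \<open>pochhammer_add_ge\<close>. The reserved count \<open>m\<close> keeps the running total
  positive throughout, while the \<open>N k\<close> may be zero.\<close>

lemma ln_pochhammer_add_sum_ge:
  fixes a :: real
  assumes "finite B" "0 < a" "0 < m"
  shows "ln (pochhammer a m) + (\<Sum>k\<in>B. ln (pochhammer a (N k)) + ln (1 + real (N k) / a))
    \<le> ln (pochhammer a (m + (\<Sum>k\<in>B. N k)))"
  using assms(1)
proof (induction B rule: finite_induct)
  case empty
  then show ?case by simp
next
  case (insert x B)
  let ?M = "m + (\<Sum>k\<in>B. N k)"
  have pos: "0 < pochhammer a l" for l
    using assms(2) by (rule pochhammer_pos)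
  have pos': "0 < 1 + real (N x) / a"
    using assms(2) by (simp add: add_pos_nonneg)
  have "ln (pochhammer a ?M) + (ln (pochhammer a (N x)) + ln (1 + real (N x) / a))
      = ln (pochhammer a ?M * (pochhammer a (N x) * (1 + real (N x) / a)))"
    using pos pos' by (simp add: ln_mult_pos)
  also have "\<dots> \<le> ln (pochhammer a (?M + N x))"
    using pos pos' assms(2,3) by (intro ln_mono pochhammer_add_ge mult_pos_pos) auto
  finally show ?case
    using insert by (simp add: ac_simps)
qed

text \<open>Only the first factor is used to gain \<open>q\<close>: it is \<open>a / q\<close>
  instead of \<open>a\<close>. The other factors are bounded by those for \<open>a\<close>, and for
  \<open>n = 0\<close> both products are empty.\<close>

lemma ln_pochhammer_divide_le:
  fixes a q :: real
  assumes "0 < a" "1 \<le> q"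
  shows "ln (pochhammer (a / q) n) \<le> ln (pochhammer a n) - (if n > 0 then ln q else 0)"
proof (cases n)
  case 0
  then show ?thesis by simp
next
  case (Suc l)
  have le: "a / q \<le> a" using assms by (simp add: field_simps mult_le_cancel_left)
  have "pochhammer (a / q) n = a / q * pochhammer (a / q + 1) l"
    by (simp add: Suc pochhammer_rec)
  also have "\<dots> \<le> a / q * pochhammer (a + 1) l"
    using assms le by (intro mult_left_mono pochhammer_mono) (auto intro: add_pos_pos)
  also have "\<dots> = pochhammer a n / q"
    by (simp add: Suc pochhammer_rec)
  finally have "ln (pochhammer (a / q) n) \<le> ln (pochhammer a n / q)"
    using assms by (intro ln_mono pochhammer_pos) auto
  also have "\<dots> = ln (pochhammer a n) - ln q"
    using assms pochhammer_pos[of a n] by (simp add: ln_div)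
  finally show ?thesis using Suc by simp
qed

section \<open>Sums of counts with the smallest positive count omitted\<close>

text \<open>This removes the ordering from the definition of g. Zero entries contribute nothing
  because \<open>h 0 = 0\<close>, so stopping just before the last positive entry leaves out only
  that entry, which is the smallest positive one.\<close>

lemma sorted_desc_sum_without_last_pos:
  fixes L :: "nat list" and h :: "nat \<Rightarrow> real"
  assumes L: "sorted_wrt (\<ge>) L" and pos: "\<exists>y\<in>set L. y > 0" and h0: "h 0 = 0"
  defines "m \<equiv> Max {l \<in> {1..length L}. L ! (l - 1) > 0}"
  shows "\<exists>y\<in>set L. y > 0 \<and> (\<forall>z\<in>set L. z > 0 \<longrightarrow> y \<le> z) \<and>
    (\<Sum>l\<in>{1..m - 1}. h (L ! (l - 1))) = (\<Sum>z\<leftarrow>L. h z) - h y"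
proof -
  let ?P = "{l \<in> {1..length L}. L ! (l - 1) > 0}"
  obtain t where t: "t < length L" "L ! t > 0"
    using pos by (metis in_set_conv_nth)
  have "Suc t \<in> ?P" using t by auto
  then have "m \<in> ?P" unfolding m_def by (intro Max_in) auto
  then have m: "1 \<le> m" "m \<le> length L" "L ! (m - 1) > 0" by auto
  \<comment> \<open>Positions \<open>s\<close> count from 0 and \<open>m\<close> counts from 1, so
    the last positive entry sits at position \<open>m - 1\<close>.\<close>
  have idx: "s < m" if "s < length L" "L ! s > 0" for s
  proof -
    have "Suc s \<in> ?P" using that by auto
    then have "Suc s \<le> m" unfolding m_def by (intro Max_ge) auto
    then show ?thesis by simp
  qed
  have desc: "L ! (m - 1) \<le> L ! s" if "s < m" for s
  proof (cases "s = m - 1")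
    case False
    then show ?thesis
      using L m that by (auto simp: sorted_wrt_iff_nth_less)
  qed simp
  have "(\<Sum>z\<leftarrow>L. h z) = (\<Sum>s<length L. h (L ! s))"
    by (simp add: sum_list_sum_nth atLeast0LessThan)
  also have "\<dots> = (\<Sum>s<m. h (L ! s))"
  proof (rule sum.mono_neutral_right)
    show "\<forall>s\<in>{..<length L} - {..<m}. h (L ! s) = 0"
    proof
      fix s assume "s \<in> {..<length L} - {..<m}"
      then have "L ! s = 0" using idx[of s] by auto
      then show "h (L ! s) = 0" by (simp add: h0)
    qed
  qed (use m in auto)
  also have "\<dots> = (\<Sum>s<m - 1. h (L ! s)) + h (L ! (m - 1))"
    using m(1) by (cases m) auto
  also have "(\<Sum>s<m - 1. h (L ! s)) = (\<Sum>l\<in>{1..m - 1}. h (L ! (l - 1)))"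
    by (rule sum.reindex_bij_witness[where i = "\<lambda>l. l - 1" and j = Suc]) auto
  finally have "(\<Sum>l\<in>{1..m - 1}. h (L ! (l - 1))) = (\<Sum>z\<leftarrow>L. h z) - h (L ! (m - 1))"
    by simp
  moreover have "L ! (m - 1) \<in> set L" using m by simp
  moreover have "\<forall>z\<in>set L. z > 0 \<longrightarrow> L ! (m - 1) \<le> z"
    using idx desc by (metis in_set_conv_nth)
  ultimately show ?thesis using m(3) by blast
qed

text \<open>The omitted indices \<open>x\<close> and \<open>y\<close> may differ, so the sums cannot
  be compared index by index. An exchange repairs this: the left term at \<open>x\<close> is paired
  with the right term at \<open>y\<close>, and all other indices are paired with themselves.\<close>

lemma sum_without_min_pos_mono:
  fixes h h' :: "nat \<Rightarrow> real"
  assumes "finite A" "x \<in> A" "y \<in> A"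
    and min: "\<And>k. k \<in> A \<Longrightarrow> M k > 0 \<Longrightarrow> M x \<le> M k"
    and "N y > 0"
    and NM: "\<And>k. k \<in> A \<Longrightarrow> N k \<le> M k"
    and h: "\<And>p r. p \<le> r \<Longrightarrow> h p \<le> h' r"
  shows "(\<Sum>k\<in>A - {y}. h (N k)) \<le> (\<Sum>k\<in>A - {x}. h' (M k))"
proof (cases "x = y")
  case True
  then show ?thesis using NM h by (auto intro!: sum_mono)
next
  case False
  have "(\<Sum>k\<in>A - {y}. h (N k)) = h (N x) + (\<Sum>k\<in>A - {y} - {x}. h (N k))"
    using assms False by (subst sum.remove[of _ x]) auto
  also have "\<dots> \<le> h' (M y) + (\<Sum>k\<in>A - {x} - {y}. h' (M k))"
  proof (rule add_mono)
    \<comment> \<open>The exchanged pair is ordered by \<open>N x \<le> M x \<le> M y\<close>; the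
      second inequality is minimality of \<open>M x\<close> among the positive values.\<close>
    have "M y > 0" using NM[OF \<open>y \<in> A\<close>] \<open>N y > 0\<close> by simp
    then have "M x \<le> M y" using min \<open>y \<in> A\<close> by blast
    then show "h (N x) \<le> h' (M y)" using NM[OF \<open>x \<in> A\<close>] by (intro h) simp
    have "A - {y} - {x} = A - {x} - {y}" by auto
    then show "(\<Sum>k\<in>A - {y} - {x}. h (N k)) \<le> (\<Sum>k\<in>A - {x} - {y}. h' (M k))"
      using NM h by (auto intro!: sum_mono)
  qed
  also have "\<dots> = (\<Sum>k\<in>A - {x}. h' (M k))"
    using assms False by (subst (2) sum.remove[of _ y]) auto
  finally show ?thesis .
qed

section \<open>Projections of the data\<close>

lemma distinct_data_eq: "distinct_data D S = (\<lambda>x. restrict x S) ` set_mset D"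
  by (simp add: distinct_data_def data_proj_def)

lemma restrict_in_distinct_data:
  assumes "j \<in> distinct_data D T" "S \<subseteq> T"
  shows "restrict j S \<in> distinct_data D S"
  using assms by (auto simp: distinct_data_eq Int_absorb1)

lemma finite_distinct_data [simp]: "finite (distinct_data D S)"
  by (simp add: distinct_data_eq)

lemma card_distinct_data_mono:
  assumes "S \<subseteq> T"
  shows "card (distinct_data D S) \<le> card (distinct_data D T)"
proof -
  have "distinct_data D S = (\<lambda>x. restrict x S) ` distinct_data D T"
    using assms by (auto simp: distinct_data_eq image_image Int_absorb1)
  then show ?thesis by (simp add: card_image_le)
qed

lemma parent_count_eq: "parent_count D S j = size {#x \<in># D. restrict x S = j#}"
  unfolding parent_count_def data_proj_def count_conv_size_mset filter_mset_image_mset size_image_mset ..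

lemma family_count_eq:
  assumes "i \<notin> S"
  shows "family_count D i S j k = size {#x \<in># D. restrict x S = j \<and> x i = k#}"
proof -
  have "(S \<union> {i}) \<inter> S = S" by auto
  then show ?thesis
    by (simp add: family_count_def data_proj_def filter_mset_image_mset)
qed

lemma family_count_mono:
  assumes "i \<notin> T" "S \<subseteq> T" "restrict j T = j"
  shows "family_count D i T j k \<le> family_count D i S (restrict j S) k"
proof -
  have "i \<notin> S" using assms by auto
  have "restrict x S = restrict j S" if "restrict x T = j" for x
    using that assms(2) by (auto simp: Int_absorb1)
  then show ?thesis
    unfolding family_count_eq[OF assms(1)] family_count_eq[OF \<open>i \<notin> S\<close>]
    by (intro size_mset_mono filter_mset_mono_strong) auto
qed

text \<open>The sets of distinct extensions partition the distinct data on
  \<open>S \<union> {i}\<close> by their \<open>S\<close>-part. In this form, monotonicity of f in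
  the parent set reduces to that of a cardinality.\<close>

lemma f_total_eq:
  "f_total c D i S = - ln (real (card (c i))) * real (card (distinct_data D (S \<union> {i})))"
proof -
  have "(\<Sum>j\<in>distinct_data D S. card (distinct_extensions D i S j))
      = (\<Sum>j\<in>distinct_data D S.
          \<Sum>x\<in>{x \<in> distinct_data D (S \<union> {i}). restrict x S = j}. 1)"
    by (simp add: distinct_extensions_def)
  also have "\<dots> = card (distinct_data D (S \<union> {i}))"
    by (subst sum.group) (auto intro: restrict_in_distinct_data)
  finally show ?thesis
    unfolding f_total_def f_local_def
    by (simp add: sum_negf flip: sum_distrib_right of_nat_sum)
qed

section \<open>Counts in data over finite nonempty state spaces\<close>

locale categorical_data =
  fixes V :: "'v set" and c :: "'v \<Rightarrow> 'a set" and D :: "('v \<Rightarrow> 'a) multiset" and i :: 'v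
  assumes finite_V: "finite V"
    and child: "i \<in> V"
    and finite_states: "\<And>v. v \<in> V \<Longrightarrow> finite (c v)"
    and states_nonempty: "\<And>v. v \<in> V \<Longrightarrow> c v \<noteq> {}"
    and data: "set_mset D \<subseteq> joint_states c V"
begin

lemma child_state: "x \<in># D \<Longrightarrow> x i \<in> c i"
  using data child by (auto simp: joint_states_def)

lemma card_child_ge_1: "1 \<le> card (c i)"
  using finite_states[OF child] states_nonempty[OF child] by (simp add: Suc_le_eq card_gt_0_iff)

lemma num_states_pos:
  assumes "S \<subseteq> V"
  shows "0 < num_states c S"
proof -
  have "finite S" using assms finite_V finite_subset by blast
  then show ?thesis
    using assms finite_states states_nonempty
    by (auto simp: num_states_def joint_states_def card_PiE card_gt_0_iff intro!: prod_pos)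
qed

lemma num_states_mono:
  assumes "S \<subseteq> T" "T \<subseteq> V"
  shows "num_states c S \<le> num_states c T"
proof -
  have "finite T" using assms(2) finite_V by (rule finite_subset)
  with assms(1) have "finite S" by (rule finite_subset)
  have "1 \<le> card (c v)" if "v \<in> T" for v
    using that assms(2) finite_states states_nonempty by (auto simp: Suc_le_eq card_gt_0_iff)
  then have "1 \<le> (\<Prod>v\<in>T - S. card (c v))"
    by (intro prod_ge_1) auto
  then have "(\<Prod>v\<in>S. card (c v)) * 1 \<le> (\<Prod>v\<in>S. card (c v)) * (\<Prod>v\<in>T - S. card (c v))"
    by (rule mult_left_mono) simp
  also have "\<dots> = (\<Prod>v\<in>T. card (c v))"
    using prod.subset_diff[OF assms(1) \<open>finite T\<close>, of "\<lambda>v. card (c v)"] by (simp add: mult.commute)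
  finally show ?thesis
    unfolding num_states_def joint_states_def card_PiE[OF \<open>finite T\<close>] card_PiE[OF \<open>finite S\<close>]
    by simp
qed

lemma sum_family_count:
  assumes "i \<notin> S"
  shows "(\<Sum>k\<in>c i. family_count D i S j k) = parent_count D S j"
proof -
  \<comment> \<open>Stated for an arbitrary multiset \<open>E\<close>, since \<open>D\<close> is
    fixed by the locale and cannot be the subject of the induction.\<close>
  have total: "size {#x \<in># E. restrict x S = j#}
      = (\<Sum>k\<in>c i. size {#x \<in># E. restrict x S = j \<and> x i = k#})"
    if "\<And>x. x \<in># E \<Longrightarrow> x i \<in> c i" for E
    using that
  proof (induction E)
    case empty
    then show ?case by simp
  next
    case (add y E)
    \<comment> \<open>The new point \<open>y\<close> affects only the summand
      \<open>k = y i\<close>, which is present because \<open>y i\<close> is a child state.\<close>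
    have "(\<Sum>k\<in>c i. size {#x \<in># add_mset y E. restrict x S = j \<and> x i = k#})
        = (\<Sum>k\<in>c i. size {#x \<in># E. restrict x S = j \<and> x i = k#}
            + (if k = y i then if restrict y S = j then 1 else 0 else 0))"
      by (intro sum.cong) auto
    also have "\<dots> = size {#x \<in># E. restrict x S = j#} + (if restrict y S = j then 1 else 0)"
    proof -
      have "(\<Sum>k\<in>c i. size {#x \<in># E. restrict x S = j \<and> x i = k#})
          = size {#x \<in># E. restrict x S = j#}"
        by (rule add.IH[symmetric]) (use add.prems in auto)
      moreover have "y i \<in> c i" using add.prems by simp
      ultimately show ?thesis
        unfolding sum.distrib using finite_states[OF child] by simp
    qed
    also have "\<dots> = size {#x \<in># add_mset y E. restrict x S = j#}"
      by simp
    finally show ?case by (rule sym)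
  qed
  show ?thesis
    unfolding family_count_eq[OF assms] parent_count_eq by (rule total[symmetric]) (rule child_state)
qed

lemma family_count_pos_iff:
  assumes "i \<notin> S"
  shows "family_count D i S j k > 0 \<longleftrightarrow> (\<exists>x\<in>#D. restrict x S = j \<and> x i = k)"
  unfolding family_count_eq[OF assms] nonempty_has_size[symmetric] filter_mset_eq_mempty_iff
  by blast

text \<open>An extension of \<open>j\<close> is determined by its value at \<open>i\<close>, and the
  values that occur are the child states with positive count. Thus f charges one
  \<open>ln q(i)\<close> per positive count, matching
  \<open>ln_pochhammer_divide_le\<close>.\<close>

lemma card_distinct_extensions:
  assumes "i \<notin> S"
  shows "card (distinct_extensions D i S j) = card {k \<in> c i. family_count D i S j k > 0}"
proof (rule bij_betw_same_card[of "\<lambda>x. x i"])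
  have int: "(S \<union> {i}) \<inter> S = S" by auto
  have ext: "distinct_extensions D i S j
      = (\<lambda>x. restrict x (S \<union> {i})) ` {x \<in> set_mset D. restrict x S = j}"
    by (auto simp: distinct_extensions_def distinct_data_eq image_def int simp del: Un_insert_right)
  have "inj_on (\<lambda>x. x i) (distinct_extensions D i S j)"
  proof (rule inj_onI)
    fix y z
    assume "y \<in> distinct_extensions D i S j" "z \<in> distinct_extensions D i S j" "y i = z i"
    then obtain x x' where x: "y = restrict x (S \<union> {i})" "restrict x S = j"
      and x': "z = restrict x' (S \<union> {i})" "restrict x' S = j" and "x i = x' i"
      unfolding ext by auto
    have "x v = x' v" if "v \<in> S" for v
      using x(2) x'(2) that by (metis restrict_apply')
    then show "y = z"
      unfolding x(1) x'(1) using \<open>x i = x' i\<close> by (intro restrict_ext) auto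
  qed
  moreover have "(\<lambda>x. x i) ` distinct_extensions D i S j
      = {k \<in> c i. family_count D i S j k > 0}"
    unfolding ext image_image family_count_pos_iff[OF assms] using child_state by (simp add: image_def) blast
  ultimately show "bij_betw (\<lambda>x. x i) (distinct_extensions D i S j)
      {k \<in> c i. family_count D i S j k > 0}"
    by (rule bij_betw_imageI)
qed

section \<open>Order-free form, sign and monotonicity of g\<close>

lemma g_local_eq:
  assumes "i \<notin> S" "j \<in> distinct_data D S"
  obtains x where "x \<in> c i" "family_count D i S j x > 0"
    "\<And>k. k \<in> c i \<Longrightarrow> family_count D i S j k > 0 \<Longrightarrow>
       family_count D i S j x \<le> family_count D i S j k"
    "g_local c D i S j \<alpha> = - (\<Sum>k\<in>c i - {x}. ln (1 + real (family_count D i S j k) / \<alpha>))"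
proof -
  define L where "L = sorted_counts c D i S j"
  let ?N = "family_count D i S j" and ?h = "\<lambda>p. ln (1 + real p / \<alpha>)"
  have mset_L: "mset L = image_mset ?N (mset_set (c i))"
    by (simp add: L_def sorted_counts_def)
  have set_L: "set L = ?N ` c i"
    using finite_states[OF child] by (simp add: mset_L flip: set_mset_mset)
  have len_L: "length L = card (c i)"
    by (simp add: mset_L flip: size_mset)
  have sum_L: "(\<Sum>z\<leftarrow>L. ?h z) = (\<Sum>k\<in>c i. ?h (?N k))"
  proof -
    have "(\<Sum>z\<leftarrow>L. ?h z) = (\<Sum>z\<in>#mset L. ?h z)"
      by (metis mset_map sum_mset_sum_list)
    then show ?thesis by (simp add: mset_L sum_unfold_sum_mset image_mset.compositionality comp_def)
  qed
  have desc: "sorted_wrt (\<ge>) L"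
    by (simp add: L_def sorted_counts_def sorted_wrt_rev)
  \<comment> \<open>A data point projecting to \<open>j\<close> supplies a positive count, so the
    maximum defining \<open>last_pos_index\<close> is over a nonempty set.\<close>
  obtain x0 where "x0 \<in># D" "restrict x0 S = j"
    using assms(2) by (auto simp: distinct_data_eq)
  then have "?N (x0 i) > 0" "x0 i \<in> c i"
    using child_state family_count_pos_iff[OF assms(1)] by auto
  then have "\<exists>y\<in>set L. y > 0" by (auto simp: set_L)
  from sorted_desc_sum_without_last_pos[OF desc this, of ?h]
  obtain y where y: "y \<in> set L" "y > 0" "\<forall>z\<in>set L. z > 0 \<longrightarrow> y \<le> z"
    and eq: "(\<Sum>l\<in>{1..last_pos_index c D i S j - 1}. ?h (L ! (l - 1))) = (\<Sum>z\<leftarrow>L. ?h z) - ?h y"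
    by (auto simp: last_pos_index_def len_L simp flip: L_def)
  then obtain x where x: "x \<in> c i" "y = ?N x" by (auto simp: set_L)
  have "g_local c D i S j \<alpha> = - (\<Sum>k\<in>c i - {x}. ?h (?N k))"
    unfolding g_local_def L_def[symmetric] eq sum_L x(2)
    using x(1) finite_states[OF child] by (subst sum.remove[of _ x]) auto
  then show thesis using that[of x] x y set_L by auto
qed

lemma g_local_nonpos:
  assumes "i \<notin> S" "j \<in> distinct_data D S" "\<alpha> > 0"
  shows "g_local c D i S j \<alpha> \<le> 0"
proof -
  obtain x where "g_local c D i S j \<alpha>
      = - (\<Sum>k\<in>c i - {x}. ln (1 + real (family_count D i S j k) / \<alpha>))"
    using g_local_eq[OF assms(1,2)] by blast
  then show ?thesis using assms(3) by (auto intro!: sum_nonneg ln_ge_zero)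
qed

text \<open>Passing from \<open>T\<close> to the coarser \<open>S\<close> merges configurations and
  can only raise the counts, and a smaller \<open>\<alpha>\<close> enlarges each logarithm. The
  child state omitted may change on the way, which \<open>sum_without_min_pos_mono\<close>
  handles.\<close>

lemma g_local_mono:
  assumes "i \<notin> T" "S \<subseteq> T" "j \<in> distinct_data D T" "0 < \<alpha>" "\<alpha> \<le> \<beta>"
  shows "g_local c D i S (restrict j S) \<alpha> \<le> g_local c D i T j \<beta>"
proof -
  have "i \<notin> S" using assms by auto
  have jT: "restrict j T = j" using assms(3) by (auto simp: distinct_data_eq)
  obtain x where x: "x \<in> c i"
    "\<And>k. k \<in> c i \<Longrightarrow> family_count D i S (restrict j S) k > 0 \<Longrightarrow>
       family_count D i S (restrict j S) x \<le> family_count D i S (restrict j S) k"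
    "g_local c D i S (restrict j S) \<alpha>
      = - (\<Sum>k\<in>c i - {x}. ln (1 + real (family_count D i S (restrict j S) k) / \<alpha>))"
    using g_local_eq[OF \<open>i \<notin> S\<close> restrict_in_distinct_data[OF assms(3,2)]] by blast
  obtain y where y: "y \<in> c i" "family_count D i T j y > 0"
    "g_local c D i T j \<beta> = - (\<Sum>k\<in>c i - {y}. ln (1 + real (family_count D i T j k) / \<beta>))"
    using g_local_eq[OF assms(1,3)] by blast
  have "ln (1 + real p / \<beta>) \<le> ln (1 + real r / \<alpha>)" if "p \<le> r" for p r
    using assms(4,5) that by (intro ln_mono add_left_mono frac_le) (auto simp: add_pos_nonneg)
  then have "(\<Sum>k\<in>c i - {y}. ln (1 + real (family_count D i T j k) / \<beta>))
      \<le> (\<Sum>k\<in>c i - {x}. ln (1 + real (family_count D i S (restrict j S) k) / \<alpha>))"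
    using x y family_count_mono[OF assms(1,2) jT] finite_states[OF child]
    by (intro sum_without_min_pos_mono[where h = "\<lambda>p. ln (1 + real p / \<beta>)"
          and h' = "\<lambda>p. ln (1 + real p / \<alpha>)"]) auto
  then show ?thesis unfolding x(3) y(3) by simp
qed

section \<open>Bound on the local score by f and g\<close>

lemma LLBDeu_le:
  assumes S: "S \<subseteq> V - {i}" and j: "j \<in> distinct_data D S" and "\<alpha>ess > 0"
  shows "LLBDeu c D \<alpha>ess i S j
    \<le> f_local c D i S j + g_local c D i S j (\<alpha>ess / real (num_states c S))"
proof -
  define a where "a = \<alpha>ess / real (num_states c S)"
  define q where "q = real (card (c i))"
  define N where "N = family_count D i S j"
  have iS: "i \<notin> S" using S by auto
  have fin: "finite (c i)" using finite_states[OF child] .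
  have a: "a > 0"
    using num_states_pos[of S] S \<open>\<alpha>ess > 0\<close> by (simp add: a_def subset_Diff_insert)
  have q: "q \<ge> 1" using card_child_ge_1 by (simp add: q_def)
  obtain x where x: "x \<in> c i" "N x > 0"
    and g: "g_local c D i S j a = - (\<Sum>k\<in>c i - {x}. ln (1 + real (N k) / a))"
    unfolding N_def using g_local_eq[OF iS j] by blast
  \<comment> \<open>The losses of \<open>ln q\<close> over the child states with positive count add
    up to the f term.\<close>
  have f: "(\<Sum>k\<in>c i. if N k > 0 then ln q else 0) = - f_local c D i S j"
    using fin by (simp add: f_local_def card_distinct_extensions[OF iS] N_def q_def
        flip: sum.inter_filter)
  have LLB: "LLBDeu c D \<alpha>ess i S j = - ln (pochhammer a (\<Sum>k\<in>c i. N k))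
      + (\<Sum>k\<in>c i. ln (pochhammer (a / q) (N k)))"
  proof -
    have "0 < a / q" using a q by simp
    moreover have "\<alpha>ess / (real (num_states c S) * real (card (c i))) = a / q"
      by (simp add: a_def q_def)
    ultimately show ?thesis
      unfolding N_def sum_family_count[OF iS] LLBDeu_def
      by (simp add: a Gamma_quot_eq_pochhammer flip: a_def)
  qed
  have "(\<Sum>k\<in>c i. ln (pochhammer (a / q) (N k)))
      \<le> (\<Sum>k\<in>c i. ln (pochhammer a (N k)) - (if N k > 0 then ln q else 0))"
    using a q by (intro sum_mono ln_pochhammer_divide_le)
  also have "\<dots> = (\<Sum>k\<in>c i. ln (pochhammer a (N k))) + f_local c D i S j"
    by (simp add: sum_subtractf f)
  also have "(\<Sum>k\<in>c i. ln (pochhammer a (N k)))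
      = ln (pochhammer a (N x)) + (\<Sum>k\<in>c i - {x}. ln (pochhammer a (N k)))"
    using fin x(1) by (rule sum.remove)
  finally have "LLBDeu c D \<alpha>ess i S j \<le> - ln (pochhammer a (\<Sum>k\<in>c i. N k))
      + ln (pochhammer a (N x)) + (\<Sum>k\<in>c i - {x}. ln (pochhammer a (N k)))
      + f_local c D i S j"
    by (simp add: LLB)
  \<comment> \<open>The state \<open>x\<close> omitted by g provides the reserved positive count;
    every other state yields one term of g.\<close>
  moreover have "ln (pochhammer a (N x))
      + (\<Sum>k\<in>c i - {x}. ln (pochhammer a (N k)) + ln (1 + real (N k) / a))
      \<le> ln (pochhammer a (\<Sum>k\<in>c i. N k))"
    using ln_pochhammer_add_sum_ge[of "c i - {x}" a "N x" N] a x fin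
    by (simp add: sum.remove[OF fin x(1), of N])
  ultimately show ?thesis
    unfolding a_def[symmetric] g by (simp add: sum.distrib)
qed

section \<open>The two inequalities for \<open>ub_g\<close>\<close>

text \<open>A data point behind \<open>jS\<close> also projects onto \<open>T\<close>. For
  \<open>T = V - {i}\<close> this makes the minima in \<open>ub_g\<close> minima of nonempty
  sets.\<close>

lemma extensions_nonempty:
  assumes "S \<subseteq> T" "jS \<in> distinct_data D S"
  shows "{j \<in> distinct_data D T. restrict j S = jS} \<noteq> {}"
  using assms by (auto simp: distinct_data_eq Int_absorb1)

lemma ub_g_le_ub_f:
  assumes S: "S \<subseteq> V - {i}" and "\<alpha>ess > 0"
  shows "ub_g V c D \<alpha>ess i S \<le> ub_f c D i S"
proof -
  define a where "a = \<alpha>ess / real (num_states c S)"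
  have a: "a > 0"
    using num_states_pos[of S] S \<open>\<alpha>ess > 0\<close> by (simp add: a_def subset_Diff_insert)
  have "Min (g ` {j \<in> distinct_data D (V - {i}). restrict j S = jS}) \<le> 0"
    if "jS \<in> distinct_data D S" "g = (\<lambda>j. g_local c D i (V - {i}) j a)" for jS g
    using extensions_nonempty[OF S that(1)] that(2) a g_local_nonpos[of "V - {i}"]
    by (auto simp: Min_le_iff)
  then show ?thesis
    unfolding ub_g_def ub_f_def a_def[symmetric] by (simp add: sum_nonpos)
qed

lemma LBDeu_le_ub_g:
  assumes ST: "S \<subseteq> T" and T: "T \<subseteq> V - {i}" and "\<alpha>ess > 0"
  shows "LBDeu c D \<alpha>ess i T \<le> ub_g V c D \<alpha>ess i S"
proof -
  define a where "a = \<alpha>ess / real (num_states c S)"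
  define b where "b = \<alpha>ess / real (num_states c T)"
  have S: "S \<subseteq> V - {i}" and iT: "i \<notin> T" using ST T by auto
  have "S \<subseteq> V" "T \<subseteq> V" using S T by auto
  then have b: "0 < b" "b \<le> a"
    using num_states_pos[of S] num_states_pos[of T] num_states_mono[of S T] ST \<open>\<alpha>ess > 0\<close>
    by (auto simp: a_def b_def intro!: divide_left_mono)
  let ?ext = "\<lambda>W jS. {j \<in> distinct_data D W. restrict j S = jS}"
  have "LBDeu c D \<alpha>ess i T \<le> (\<Sum>j\<in>distinct_data D T. f_local c D i T j + g_local c D i T j b)"
    unfolding LBDeu_def b_def using LLBDeu_le[OF T _ \<open>\<alpha>ess > 0\<close>] by (intro sum_mono)
  also have "\<dots> = f_total c D i T + (\<Sum>j\<in>distinct_data D T. g_local c D i T j b)"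
    by (simp add: sum.distrib f_total_def)
  also have "f_total c D i T \<le> f_total c D i S"
  proof -
    have "card (distinct_data D (S \<union> {i})) \<le> card (distinct_data D (T \<union> {i}))"
      using ST by (intro card_distinct_data_mono) auto
    moreover have "0 \<le> ln (real (card (c i)))"
      using card_child_ge_1 by simp
    ultimately show ?thesis
      unfolding f_total_eq by (simp add: mult_left_mono)
  qed
  \<comment> \<open>The observed configurations of \<open>T\<close> are grouped by their
    \<open>S\<close>-part, to match the outer sum of \<open>ub_g\<close>.\<close>
  also have "(\<Sum>j\<in>distinct_data D T. g_local c D i T j b)
      = (\<Sum>jS\<in>distinct_data D S. \<Sum>j\<in>?ext T jS. g_local c D i T j b)"
    using ST by (subst sum.group) (auto intro: restrict_in_distinct_data)
  also have "\<dots> \<le> (\<Sum>jS\<in>distinct_data D S.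
      Min ((\<lambda>j. g_local c D i (V - {i}) j a) ` ?ext (V - {i}) jS))"
  proof (intro sum_mono Min.boundedI)
    fix jS y
    assume "y \<in> (\<lambda>j. g_local c D i (V - {i}) j a) ` ?ext (V - {i}) jS"
    then obtain j where j: "j \<in> distinct_data D (V - {i})" "restrict j S = jS"
      and y: "y = g_local c D i (V - {i}) j a" by auto
    have jT: "restrict j T \<in> ?ext T jS"
      using j restrict_in_distinct_data[OF j(1) T] ST by (auto simp: Int_absorb1)
    have "(\<Sum>j\<in>?ext T jS. g_local c D i T j b)
        = g_local c D i T (restrict j T) b
          + (\<Sum>j\<in>?ext T jS - {restrict j T}. g_local c D i T j b)"
      using jT by (intro sum.remove) auto
    also have "\<dots> \<le> g_local c D i T (restrict j T) b"
      using g_local_nonpos[OF iT _ b(1)] by (auto intro!: sum_nonpos)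
    also have "\<dots> \<le> y"
      unfolding y using T j(1) b by (intro g_local_mono) auto
    finally show "(\<Sum>j\<in>?ext T jS. g_local c D i T j b) \<le> y" .
  qed (use extensions_nonempty[OF S] in auto)
  finally show ?thesis
    unfolding ub_g_def a_def by simp
qed

end

theorem mainTheorem2:
  fixes n i :: nat
    and V :: "nat set"
    and c :: "nat \<Rightarrow> 'a set"
    and D :: "(nat \<Rightarrow> 'a) multiset"
    and \<alpha>ess :: real
    and S :: "nat set"
  assumes "V = {1..n}"
    and "i \<in> V"
    and "\<And>v. v \<in> V \<Longrightarrow> finite (c v)"
    and "\<And>v. v \<in> V \<Longrightarrow> c v \<noteq> {}"
    and "set_mset D \<subseteq> joint_states c V"
    and "\<alpha>ess > 0"
    and "S \<subseteq> V - {i}"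
  shows "ub_g V c D \<alpha>ess i S \<le> ub_f c D i S \<and>
         (\<forall>T. S \<subset> T \<and> T \<subseteq> V - {i} \<longrightarrow> ub_g V c D \<alpha>ess i S \<ge> LBDeu c D \<alpha>ess i T)"
proof -
  interpret categorical_data V c D i
    using assms by unfold_locales auto
  show ?thesis
    using ub_g_le_ub_f[OF assms(7,6)] LBDeu_le_ub_g[OF _ _ assms(6)] by auto
qed

end
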